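(* Let $n \geq 1$ be a natural number and let $p \in [0,1]$. There exists a locally $p$-biased function $f:\{-1,1\}^{n} \rightarrow \{-1,1\}$ if and only if $p = b/2^{k}$ for some integers $b \geq 0$, $k \geq 0$ such that $2^{k}$ divides $n$.
   Context: The hypercube $\{-1,1\}^n$ is regarded as a graph in which two vertices are adjacent iff they differ in exactly one coordinate (so every vertex has $n$ neighbors). A function $f:\{-1,1\}^n\to\{-1,1\}$ is called locally $p$-biased if for every vertex $x$, $f$ takes the value $1$ on exactly a $p$-fraction of the neighbors of $x$, i.e. $|\{y\sim x : f(y)=1\}|/n = p$. *)

theory Defs
  imports Complex_Main "HOL-Library.FuncSet"
begin

text \<open>Points are extensional functions on the coordinate set \<open>{..<n}\<close>, so that equality of
  points is coordinatewise equality and the cube has exactly \<open>2 ^ n\<close> elements.\<close>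

definition hypercube :: "nat \<Rightarrow> (nat \<Rightarrow> int) set" where
  "hypercube n = {..<n} \<rightarrow>\<^sub>E {-1, 1}"

definition adjacent :: "nat \<Rightarrow> (nat \<Rightarrow> int) \<Rightarrow> (nat \<Rightarrow> int) \<Rightarrow> bool" where
  "adjacent n x y \<longleftrightarrow>
     x \<in> hypercube n \<and> y \<in> hypercube n \<and> card {i \<in> {..<n}. x i \<noteq> y i} = 1"

definition locally_biased :: "nat \<Rightarrow> real \<Rightarrow> ((nat \<Rightarrow> int) \<Rightarrow> int) \<Rightarrow> bool" where
  "locally_biased n p f \<longleftrightarrow>
     f \<in> hypercube n \<rightarrow> {-1, 1} \<and>
     (\<forall>x \<in> hypercube n. real (card {y. adjacent n x y \<and> f y = 1}) / real n = p)"

end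

theory Submission
  imports Defs "HOL-Computational_Algebra.Primes"
begin

text \<open>
  If \<open>f\<close> is locally \<open>p\<close>-biased, every vertex has the same number \<open>c = p n\<close> of neighbours in
  \<open>S = {x. f x = 1}\<close>. Counting the edges that lead into \<open>S\<close> from both ends gives
  \<open>c 2\<^sup>n = n |S|\<close>, so \<open>p = c / n = |S| / 2\<^sup>n\<close>. The reduced denominator of \<open>p\<close> therefore divides
  both \<open>n\<close> and \<open>2\<^sup>n\<close>, which makes it a power of two dividing \<open>n\<close>.

  For the converse, let \<open>n = m 2\<^sup>k\<close> and \<open>p = b / 2\<^sup>k\<close>. Label coordinate \<open>i\<close> with the
  \<open>k\<close>-bit number \<open>i mod 2\<^sup>k\<close>, so that each \<open>k\<close>-bit number labels exactly \<open>m\<close> coordinates, and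
  send \<open>x\<close> to its syndrome \<open>s x\<close>, the exclusive or of the labels of the coordinates at which \<open>x\<close>
  is \<open>1\<close>. As in a Hamming code, flipping coordinate \<open>i\<close> changes the syndrome by the label of \<open>i\<close>.
  Since exclusive or with a fixed number permutes the \<open>k\<close>-bit numbers, every \<open>k\<close>-bit number is the
  syndrome of exactly \<open>m\<close> neighbours of any given \<open>x\<close>. The function that is \<open>1\<close> where
  \<open>s x\<close> lies in a fixed set of \<open>b\<close> values, say \<open>s x < b\<close>, is then \<open>1\<close> on \<open>m b\<close> of the
  \<open>m 2\<^sup>k\<close> neighbours.
\<close>

lemma finite_hypercube: "finite (hypercube n)"
  unfolding hypercube_def by (intro finite_PiE) auto

lemma card_hypercube: "card (hypercube n) = 2 ^ n"
  unfolding hypercube_def by (simp add: card_PiE numeral_2_eq_2)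

lemma adjacent_sym: "adjacent n x y \<longleftrightarrow> adjacent n y x"
  unfolding adjacent_def by (simp add: eq_commute conj_ac)

lemma hypercube_cases:
  assumes "x \<in> hypercube n" "i < n"
  shows "x i = 1 \<or> x i = -1"
  using assms unfolding hypercube_def by (auto dest: PiE_mem)

lemma adjacent_iff_flip:
  assumes x: "x \<in> hypercube n"
  shows "adjacent n x y \<longleftrightarrow> (\<exists>i<n. y = x(i := - x i))"
proof
  assume adj: "adjacent n x y"
  then have y: "y \<in> hypercube n" and "card {i \<in> {..<n}. x i \<noteq> y i} = 1"
    by (simp_all only: adjacent_def)
  from this(2) obtain i where i: "{i \<in> {..<n}. x i \<noteq> y i} = {i}"
    by (rule card_1_singletonE)
  then have diff: "j < n \<and> x j \<noteq> y j \<longleftrightarrow> j = i" for j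
    by blast
  have "y j = (x(i := - x i)) j" for j
  proof (cases "j < n")
    case True
    then show ?thesis
      using diff[of j] hypercube_cases[OF x True] hypercube_cases[OF y True] by auto
  next
    case False
    then show ?thesis
      using diff[of j] diff[of i] x y by (auto simp: hypercube_def PiE_def extensional_def)
  qed
  then show "\<exists>i<n. y = x(i := - x i)" using diff[of i] by blast
next
  assume "\<exists>i<n. y = x(i := - x i)"
  then obtain i where i: "i < n" "y = x(i := - x i)" by blast
  have "x i \<noteq> - x i" using hypercube_cases[OF x i(1)] by auto
  then have "{j \<in> {..<n}. x j \<noteq> y j} = {i}" using i by auto
  moreover have "y \<in> hypercube n"
    using x i hypercube_cases[OF x i(1)]
    by (auto simp: hypercube_def PiE_def extensional_def Pi_def)
  ultimately show "adjacent n x y" using x by (simp add: adjacent_def)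
qed

lemma card_neighbours_eq_card_flips:
  assumes x: "x \<in> hypercube n"
  shows "card {y. adjacent n x y \<and> P y} = card {i. i < n \<and> P (x(i := - x i))}"
proof -
  have "inj_on (\<lambda>i. x(i := - x i)) {..<n}"
  proof (rule inj_onI)
    fix i j assume "i \<in> {..<n}" and eq: "x(i := - x i) = x(j := - x j)"
    then have "x i \<noteq> - x i" using hypercube_cases[OF x, of i] by auto
    with fun_cong[OF eq, of i] show "i = j" by (auto split: if_splits)
  qed
  then have "inj_on (\<lambda>i. x(i := - x i)) {i. i < n \<and> P (x(i := - x i))}"
    by (rule inj_on_subset) auto
  moreover have "{y. adjacent n x y \<and> P y} =
      (\<lambda>i. x(i := - x i)) ` {i. i < n \<and> P (x(i := - x i))}"
    using adjacent_iff_flip[OF x] by auto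
  ultimately show ?thesis by (simp add: card_image)
qed

text \<open>Both sides count the pairs of adjacent vertices whose second member satisfies \<open>P\<close>.\<close>

lemma double_count_neighbours:
  "(\<Sum>x\<in>hypercube n. card {y. adjacent n x y \<and> P y}) = n * card {y \<in> hypercube n. P y}"
proof -
  let ?C = "hypercube n"
  have "(\<Sum>x\<in>?C. card {y. adjacent n x y \<and> P y})
      = (\<Sum>x\<in>?C. \<Sum>y\<in>{y \<in> {y \<in> ?C. P y}. adjacent n x y}. 1)"
    by (intro sum.cong refl) (auto simp: adjacent_def intro!: arg_cong[where f = card])
  also have "\<dots> = (\<Sum>y\<in>{y \<in> ?C. P y}. \<Sum>x\<in>{x \<in> ?C. adjacent n x y}. 1)"
    by (rule sum.swap_restrict) (auto simp: finite_hypercube)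
  also have "\<dots> = (\<Sum>y\<in>{y \<in> ?C. P y}. n)"
  proof (intro sum.cong refl)
    fix y assume "y \<in> {y \<in> ?C. P y}"
    then have y: "y \<in> ?C" by simp
    have "{x \<in> ?C. adjacent n x y} = {x. adjacent n y x \<and> True}"
      using adjacent_sym by (auto simp: adjacent_def)
    then show "(\<Sum>x\<in>{x \<in> ?C. adjacent n x y}. 1) = n"
      using card_neighbours_eq_card_flips[OF y, of "\<lambda>_. True"] by simp
  qed
  finally show ?thesis by (simp add: mult.commute)
qed

text \<open>The equation says \<open>c / n = s / 2\<^sup>N\<close>; the denominator of the reduced form of this fraction
  divides both \<open>n\<close> and \<open>2\<^sup>N\<close>.\<close>

lemma dyadic_denominator_dvd:
  fixes c n s N :: nat
  assumes "n > 0" and eq: "c * 2 ^ N = n * s"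
  shows "\<exists>b k. real c / real n = real b / 2 ^ k \<and> 2 ^ k dvd n"
proof -
  obtain c' n' where c: "c = gcd c n * c'" and n: "n = gcd c n * n'" and cop: "coprime c' n'"
    using gcd_coprime_exists[of c n] assms(1) by (metis gcd_eq_0_iff mult.commute not_gr_zero)
  have "gcd c n * (c' * 2 ^ N) = gcd c n * (n' * s)"
    using eq c n by (metis mult.assoc)
  then have "c' * 2 ^ N = n' * s"
    using assms(1) by simp
  then have "n' dvd c' * 2 ^ N" by simp
  then have "n' dvd 2 ^ N"
    using cop by (simp add: coprime_commute coprime_dvd_mult_right_iff)
  then obtain k where k: "n' = 2 ^ k"
    using divides_primepow_nat[OF two_is_prime_nat] by blast
  have "real c / real n = real (gcd c n * c') / real (gcd c n * n')"
    using c n by simp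
  also have "\<dots> = real c' / 2 ^ k" using assms(1) k by simp
  finally show ?thesis using n k by (metis dvd_triv_right)
qed

lemma locally_biased_imp_dyadic:
  assumes "n \<ge> 1" and f: "locally_biased n p f"
  shows "\<exists>b k :: nat. p = real b / 2 ^ k \<and> 2 ^ k dvd n"
proof -
  define deg where "deg x = card {y. adjacent n x y \<and> f y = 1}" for x
  have bias: "real (deg x) / real n = p" if "x \<in> hypercube n" for x
    using f that by (simp add: locally_biased_def deg_def)
  have "hypercube n \<noteq> {}" using card_hypercube[of n] by auto
  then obtain x0 where x0: "x0 \<in> hypercube n" by blast
  have "deg x = deg x0" if "x \<in> hypercube n" for x
    using bias[OF that] bias[OF x0] assms(1) by (auto simp: field_simps)
  then have "(\<Sum>x\<in>hypercube n. deg x) = deg x0 * 2 ^ n"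
    by (simp add: card_hypercube)
  then have "deg x0 * 2 ^ n = n * card {y \<in> hypercube n. f y = 1}"
    using double_count_neighbours[of n "\<lambda>y. f y = 1"] by (simp add: deg_def)
  from dyadic_denominator_dvd[OF _ this] show ?thesis
    using assms(1) bias[OF x0] by auto
qed

text \<open>The syndrome is computed coordinate by coordinate, so that the length \<open>n\<close> of the vector is an
  argument separate from the number \<open>k\<close> of bits in a label; this allows induction on \<open>n\<close> with the
  labelling kept the same.\<close>

primrec syndrome :: "nat \<Rightarrow> nat \<Rightarrow> (nat \<Rightarrow> int) \<Rightarrow> nat" where
  "syndrome k 0 x = 0"
| "syndrome k (Suc n) x = xor (syndrome k n x) (if x n = 1 then n mod 2 ^ k else 0)"

lemma xor_nat_less_power:
  fixes a b :: nat
  assumes "a < 2 ^ k" "b < 2 ^ k"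
  shows "xor a b < 2 ^ k"
  using assms by (metis take_bit_nat_eq_self_iff take_bit_xor)

lemma syndrome_less: "syndrome k n x < 2 ^ k"
  by (induction n) (auto intro!: xor_nat_less_power)

lemma syndrome_update_ge: "n \<le> i \<Longrightarrow> syndrome k n (x(i := v)) = syndrome k n x"
  by (induction n) auto

text \<open>Whether the label of \<open>i\<close> enters or leaves, the change is the same because exclusive or is
  its own inverse.\<close>

lemma syndrome_flip:
  assumes "i < n" "x i = 1 \<or> x i = -1"
  shows "syndrome k n (x(i := - x i)) = xor (syndrome k n x) (i mod 2 ^ k)"
  using assms
proof (induction n)
  case (Suc n)
  show ?case
  proof (cases "i = n")
    case True
    have "syndrome k n (x(i := - x i)) = syndrome k n x"
      by (rule syndrome_update_ge) (simp add: True)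
    then show ?thesis
      using Suc.prems True by (auto simp: xor.assoc simp del: fun_upd_apply) simp_all
  next
    case False
    then show ?thesis using Suc by (auto simp: ac_simps)
  qed
qed simp

lemma card_mod_eq:
  fixes N :: nat
  assumes "N > 0"
  shows "card {i. i < m * N \<and> P (i mod N)} = m * card {r. r < N \<and> P r}"
proof (induction m)
  case (Suc m)
  let ?R = "{r. r < N \<and> P r}"
  have "{i. i < Suc m * N \<and> P (i mod N)}
      = {i. i < m * N \<and> P (i mod N)} \<union> (\<lambda>r. m * N + r) ` ?R" (is "?A = ?B \<union> ?C")
  proof (intro equalityI subsetI)
    fix i assume i: "i \<in> ?A"
    show "i \<in> ?B \<union> ?C"
    proof (cases "i < m * N")
      case False
      then obtain r where r: "i = m * N + r" by (metis le_Suc_ex not_less)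
      with i have "r < N" by simp
      with i r show ?thesis by auto
    qed (use i in auto)
  qed auto
  moreover have "card ?C = card ?R" by (rule card_image) (auto simp: inj_on_def)
  moreover have "?B \<inter> ?C = {}" by auto
  ultimately show ?case using Suc by (simp add: card_Un_disjoint)
qed simp

text \<open>Exclusive or with \<open>s\<close> is an involution of the \<open>k\<close>-bit numbers, so it preserves the size of
  \<open>{..<b}\<close>.\<close>

lemma card_xor_less:
  fixes s b :: nat
  assumes "s < 2 ^ k" "b \<le> 2 ^ k"
  shows "card {r. r < 2 ^ k \<and> xor s r < b} = b"
proof -
  have xor_xor: "xor s (xor s r) = r" for r by (simp flip: xor.assoc)
  have "bij_betw (xor s) {r. r < 2 ^ k \<and> xor s r < b} {..<b}"
    by (rule bij_betwI[where g = "xor s"])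
      (use assms in \<open>auto simp: xor_xor intro!: xor_nat_less_power\<close>)
  then show ?thesis by (simp add: bij_betw_same_card)
qed

lemma dyadic_imp_locally_biased:
  assumes "n \<ge> 1" "2 ^ k dvd n" "b \<le> 2 ^ k"
  shows "locally_biased n (real b / 2 ^ k) (\<lambda>x. if syndrome k n x < b then 1 else -1)"
proof -
  obtain m where m: "n = m * 2 ^ k" using assms(2) by (auto simp: mult.commute)
  have "card {y. adjacent n x y \<and> syndrome k n y < b} = m * b" if x: "x \<in> hypercube n" for x
  proof -
    have "card {y. adjacent n x y \<and> syndrome k n y < b}
        = card {i. i < n \<and> syndrome k n (x(i := - x i)) < b}"
      by (rule card_neighbours_eq_card_flips[OF x])
    also have "\<dots> = card {i. i < n \<and> xor (syndrome k n x) (i mod 2 ^ k) < b}"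
      by (intro arg_cong[where f = card] Collect_cong conj_cong refl)
        (simp only: syndrome_flip hypercube_cases[OF x])
    also have "\<dots> = m * card {r. r < 2 ^ k \<and> xor (syndrome k n x) r < b}"
      using card_mod_eq[of "2 ^ k" m "\<lambda>r. xor (syndrome k n x) r < b"] m by simp
    also have "\<dots> = m * b"
      by (simp add: card_xor_less syndrome_less assms(3))
    finally show ?thesis .
  qed
  moreover have "real (m * b) / real n = real b / 2 ^ k"
    using assms(1) m by (auto simp: field_simps)
  moreover have "((if syndrome k n y < b then 1 else -1 :: int) = 1) \<longleftrightarrow> syndrome k n y < b" for y
    by simp
  ultimately show ?thesis unfolding locally_biased_def by auto
qed

theorem theorem1p1:
  fixes n :: nat and p :: real
  assumes "n \<ge> 1" and "p \<in> {0..1}"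
  shows "(\<exists>f. locally_biased n p f) \<longleftrightarrow>
         (\<exists>b k :: nat. p = real b / 2 ^ k \<and> 2 ^ k dvd n)"
proof
  assume "\<exists>f. locally_biased n p f"
  then show "\<exists>b k :: nat. p = real b / 2 ^ k \<and> 2 ^ k dvd n"
    using locally_biased_imp_dyadic[OF assms(1)] by blast
next
  assume "\<exists>b k :: nat. p = real b / 2 ^ k \<and> 2 ^ k dvd n"
  then obtain b k :: nat where p: "p = real b / 2 ^ k" and dvd: "2 ^ k dvd n" by blast
  have "real b \<le> real (2 ^ k)" using assms(2) p by (simp add: divide_le_eq)
  then have "b \<le> 2 ^ k" by (simp only: of_nat_le_iff)
  then show "\<exists>f. locally_biased n p f"
    using dyadic_imp_locally_biased[OF assms(1) dvd] p by blast
qed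

end
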